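(* Let $a=\frac{16}{3\sqrt3}$. Let $f:(0,a)\to\mathbb{R}$ be a function such that $\int_0^a f(x)x^{2k}\,dx=D(3,k)$ for all nonnegative integers $k$ and 1. $f$ is three times continuously differentiable on $(0,a)$ and $\lim_{x\to a^-}f(x)=0$; 2. $\lim_{x\to a^-}(x-a)f'(x)=0$; 3. $\lim_{x\to a^-}\left(2(x-a)f''(x)+f'(x)\right)=0$; 4. $\lim_{x\to0^+}xf(x)=0$, $\lim_{x\to0^+}x^2f'(x)=0$, and $\lim_{x\to0^+}x^3f''(x)=0$. Then $f$ satisfies the following ODE on $(0,a)$: $$(27x^4-256x^2)f'''(x)+(162x^3-768x)f''(x)+(177x^2-192)f'(x)+15xf(x)=0.$$
   Context: $D(m,k)=\frac{1}{mk+1}\binom{(m+1)k}{k}$, so $D(3,k)=\frac{1}{3k+1}\binom{4k}{k}$. *)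

theory Defs
  imports "HOL-Analysis.Analysis"
begin

text \<open>The numbers $D(m,k) = \frac{1}{mk+1}\binom{(m+1)k}{k}$ (Fuss-Catalan numbers).\<close>

definition D_num :: "nat \<Rightarrow> nat \<Rightarrow> real" where
  "D_num m k = 1 / real (m * k + 1) * real (((m + 1) * k) choose k)"

text \<open>
  Intended for open \<open>S\<close>: there the iterates of \<^const>\<open>deriv\<close> at points of \<open>S\<close> depend only on
  the values of \<open>f\<close> on \<open>S\<close>.
\<close>

definition times_continuously_differentiable_on ::
    "nat \<Rightarrow> (real \<Rightarrow> real) \<Rightarrow> real set \<Rightarrow> bool" where
  "times_continuously_differentiable_on n f S \<longleftrightarrow>
     (\<forall>j<n. \<forall>x\<in>S. (deriv ^^ j) f differentiable (at x)) \<and>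
     continuous_on S ((deriv ^^ n) f)"

end

theory Submission
  imports Defs
begin

text \<open>
  Let \<open>L\<close> be the differential operator on the left-hand side of the equation and \<open>g = L f\<close>. Its
  adjoint acts on odd powers by
  \<open>L\<^sup>* x^(2k+1) = 8 C_k x^(2k) - 8 A_k x^(2k+2)\<close>, where
  \<open>A_k = (3k+4) (3k+3) (3k+2)\<close> and \<open>C_k = 4 (4k+3) (4k+2) (4k+1)\<close> are exactly the factors in the
  recurrence \<open>A_k D(3,k+1) = C_k D(3,k)\<close> (\<open>D_num_3_Suc\<close>). Lagrange's identity
  (\<open>lagrange_identity\<close>) writes \<open>x^(2k+1) g - f L\<^sup>* x^(2k+1)\<close> as the derivative of a boundary
  expression, and the limit hypotheses make that expression vanish at both ends. Hence every odd
  moment of \<open>g\<close> on \<open>(0,a)\<close> is zero.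

  It remains to see that a function with vanishing odd moments is zero. As \<open>g\<close> may be
  unbounded near both ends, and the integrals only conditionally convergent, the Weierstrass
  theorem cannot be applied to \<open>g\<close> itself. The Henstock--Kurzweil primitive
  \<open>W x = \<integral>\<^sub>0\<^sup>x t g t dt\<close> is however continuous on the closed interval, vanishes at both ends, and
  inherits vanishing odd moments through integration by parts. Approximating \<open>W\<close> by polynomials
  in \<open>x\<^sup>2\<close> gives \<open>W = 0\<close> (\<open>zero_if_odd_moments_zero\<close>), and differentiating gives \<open>g = 0\<close>
  (\<open>zero_if_even_moments_zero\<close>, applied to \<open>x g\<close>).
\<close>

section \<open>The recurrence of the numbers \<open>D(3,k)\<close>\<close>

lemma D_num_eq_fact: "D_num m k = fact ((m + 1) * k) / (fact k * fact (m * k + 1))"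
proof -
  have "(m + 1) * k - k = m * k" by simp
  then have "real (((m + 1) * k) choose k) = fact ((m + 1) * k) / (fact k * fact (m * k))"
    using binomial_fact[of k "(m + 1) * k", where 'a = real] by simp
  then show ?thesis unfolding D_num_def by simp
qed

text \<open>
  In \<open>D(3,k) = (4k)! / (k! (3k+1)!)\<close> the step from \<open>k\<close> to \<open>k+1\<close> contributes four factors above and
  \<open>1 + 3\<close> factors below; \<open>(4k+4) / (k+1)\<close> leaves the constant \<open>4\<close>.
\<close>

lemma D_num_3_Suc:
  "(3 * real k + 4) * (3 * real k + 3) * (3 * real k + 2) * D_num 3 (Suc k)
   = 4 * (4 * real k + 3) * (4 * real k + 2) * (4 * real k + 1) * D_num 3 k"
proof -
  have "4 * Suc k = Suc (Suc (Suc (Suc (4 * k))))" by simp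
  then have up: "(fact (4 * Suc k) :: real)
      = (4 * real k + 4) * (4 * real k + 3) * (4 * real k + 2) * (4 * real k + 1) * fact (4 * k)"
    by (simp only: fact_Suc) (simp add: algebra_simps)
  have "3 * Suc k + 1 = Suc (Suc (Suc (3 * k + 1)))" by simp
  then have down: "(fact (3 * Suc k + 1) :: real)
      = (3 * real k + 4) * (3 * real k + 3) * (3 * real k + 2) * fact (3 * k + 1)"
    by (simp only: fact_Suc) (simp add: algebra_simps)
  have left: "(fact (Suc k) :: real) = (real k + 1) * fact k" by simp
  define A B where "A = (4 * real k + 3) * (4 * real k + 2) * (4 * real k + 1)"
    and "B = (3 * real k + 4) * (3 * real k + 3) * (3 * real k + 2)"
  have "B * D_num 3 (Suc k) = B * (((4 * real k + 4) * A * fact (4 * k))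
      / (((real k + 1) * fact k) * (B * fact (3 * k + 1))))"
    unfolding D_num_eq_fact A_def B_def using up down left
    by (simp add: mult.assoc del: fact_Suc)
  also have "\<dots> = 4 * A * (fact (4 * k) / (fact k * fact (3 * k + 1)))"
  proof -
    have "B \<noteq> 0" "real k + 1 \<noteq> 0" unfolding B_def by (simp_all add: add_nonneg_eq_0_iff)
    then show ?thesis by (simp add: divide_simps del: fact_Suc)
  qed
  finally show ?thesis unfolding A_def B_def D_num_eq_fact by (simp add: mult.assoc)
qed

section \<open>Functions with vanishing moments\<close>

text \<open>
  The fundamental theorem of calculus for improper integrals: filling in the two limits as end
  values makes \<open>F\<close> continuous on the closed interval. The integral is that of Henstock and Kurzweil,
  for which every derivative is integrable, absolutely convergent or not.
\<close>

lemma has_integral_derivative_open: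
  fixes F h :: "real \<Rightarrow> real"
  assumes "a < b"
    and deriv: "\<And>x. x \<in> {a<..<b} \<Longrightarrow> (F has_real_derivative h x) (at x)"
    and lim_a: "(F \<longlongrightarrow> A) (at_right a)" and lim_b: "(F \<longlongrightarrow> B) (at_left b)"
  shows "(h has_integral B - A) {a<..<b}"
proof -
  define G where "G = (\<lambda>x. if x = a then A else if x = b then B else F x)"
  have "((\<lambda>x. if x = a then A else if x = b then B else F x) \<longlongrightarrow> A) (at_right a)"
    by (rule Lim_transform_eventually[OF lim_a])
       (use eventually_at_right_field[of _ a] \<open>a < b\<close> in auto)
  moreover have "((\<lambda>x. if x = a then A else if x = b then B else F x) \<longlongrightarrow> B) (at_left b)"
    by (rule Lim_transform_eventually[OF lim_b])
       (use eventually_at_left_field[of _ b] \<open>a < b\<close> in auto)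
  moreover have G': "(G has_real_derivative h x) (at x)" if "x \<in> {a<..<b}" for x
    by (rule has_field_derivative_transform_within_open[OF deriv[OF that], of "{a<..<b}"])
       (use that in \<open>auto simp: G_def\<close>)
  ultimately have "continuous_on {a..b} G"
    using \<open>a < b\<close>
    by (intro continuous_on_IccI) (auto simp: G_def[symmetric] G_def[THEN fun_cong, of a]
        G_def[THEN fun_cong, of b] dest: DERIV_isCont intro: isContD)
  then have "(h has_integral G b - G a) {a..b}"
    using G' \<open>a < b\<close>
    by (intro fundamental_theorem_of_calculus_interior)
       (auto simp: has_real_derivative_iff_has_vector_derivative[symmetric])
  then show ?thesis
    using \<open>a < b\<close> by (simp add: G_def has_integral_Icc_iff_Ioo)
qed

text \<open>
  The function \<open>y \<mapsto> W (sqrt y)\<close> is continuous on \<open>[0, a\<^sup>2]\<close>, so \<open>W\<close> is a uniform limit of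
  polynomials in \<open>x\<^sup>2\<close>. With the weight \<open>x\<close> all of these are orthogonal to \<open>W\<close>, so
  \<open>\<integral> x W\<^sup>2 = \<integral> x W (W - p(x\<^sup>2))\<close>, which is as small as desired.
\<close>

lemma zero_if_odd_moments_zero:
  fixes W :: "real \<Rightarrow> real"
  assumes "0 < a" and cont: "continuous_on {0..a} W"
    and mom: "\<And>k. ((\<lambda>x. x ^ (2 * k + 1) * W x) has_integral 0) {0..a}"
    and x: "x \<in> {0<..a}"
  shows "W x = 0"
proof -
  have intg: "(\<lambda>x. x * (W x)\<^sup>2) integrable_on {0..a}" "(\<lambda>x. x * \<bar>W x\<bar>) integrable_on {0..a}"
    by (intro integrable_continuous_real continuous_intros cont)+
  define C where "C = integral {0..a} (\<lambda>x. x * \<bar>W x\<bar>)"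
  have C: "0 \<le> C" unfolding C_def by (intro integral_nonneg intg) auto
  have small: "integral {0..a} (\<lambda>x. x * (W x)\<^sup>2) \<le> e * C" if "0 < e" for e
  proof -
    have "continuous_on {0..a\<^sup>2} (\<lambda>y. W (sqrt y))"
      by (rule continuous_on_compose2[OF cont])
         (use \<open>0 < a\<close> real_sqrt_le_mono[of _ "a\<^sup>2"] in \<open>auto intro!: continuous_intros\<close>)
    from Stone_Weierstrass_real_polynomial_function[OF compact_Icc this \<open>0 < e\<close>]
    obtain p where "real_polynomial_function p"
      and p: "\<And>y. y \<in> {0..a\<^sup>2} \<Longrightarrow> \<bar>W (sqrt y) - p y\<bar> < e" by blast
    then obtain c N where p_sum: "p = (\<lambda>y. \<Sum>i\<le>N. c i * y ^ i)"
      unfolding real_polynomial_function_iff_sum by blast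
    have close: "\<bar>W x - p (x\<^sup>2)\<bar> < e" if "x \<in> {0..a}" for x
      using p[of "x\<^sup>2"] that by (auto simp: power_mono)
    have "((\<lambda>x. \<Sum>i\<le>N. c i * (x ^ (2 * i + 1) * W x)) has_integral (\<Sum>i\<le>N. c i * 0)) {0..a}"
      by (intro has_integral_sum has_integral_mult_right mom) auto
    moreover have "(\<Sum>i\<le>N. c i * (x ^ (2 * i + 1) * W x)) = x * W x * p (x\<^sup>2)" for x
    proof -
      have "c i * (x ^ (2 * i + 1) * W x) = x * W x * (c i * (x\<^sup>2) ^ i)" for i
      proof -
        have "x ^ (2 * i + 1) = x * (x\<^sup>2) ^ i"
          by (metis Suc_eq_plus1 power_Suc power_mult)
        then show ?thesis by (simp only: mult_ac)
      qed
      then show ?thesis unfolding p_sum sum_distrib_left by (intro sum.cong refl)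
    qed
    ultimately have orth: "((\<lambda>x. x * W x * p (x\<^sup>2)) has_integral 0) {0..a}"
      by (simp only: mult_zero_right sum.neutral_const)
    from has_integral_diff[OF integrable_integral[OF intg(1)] orth]
    have "((\<lambda>x. x * (W x)\<^sup>2 - x * W x * p (x\<^sup>2)) has_integral
        integral {0..a} (\<lambda>x. x * (W x)\<^sup>2)) {0..a}" by simp
    moreover have "((\<lambda>x. e * (x * \<bar>W x\<bar>)) has_integral e * C) {0..a}"
      unfolding C_def by (intro has_integral_mult_right integrable_integral intg)
    moreover have "x * (W x)\<^sup>2 - x * W x * p (x\<^sup>2) \<le> e * (x * \<bar>W x\<bar>)" if "x \<in> {0..a}" for x
    proof -
      have "x * (W x)\<^sup>2 - x * W x * p (x\<^sup>2) = x * (W x * (W x - p (x\<^sup>2)))"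
        by (simp add: algebra_simps power2_eq_square)
      also have "\<dots> \<le> x * (\<bar>W x\<bar> * e)"
      proof (rule mult_left_mono)
        have "W x * (W x - p (x\<^sup>2)) \<le> \<bar>W x\<bar> * \<bar>W x - p (x\<^sup>2)\<bar>"
          by (metis abs_ge_self abs_mult)
        also have "\<dots> \<le> \<bar>W x\<bar> * e"
          using close[OF that] by (intro mult_left_mono) auto
        finally show "W x * (W x - p (x\<^sup>2)) \<le> \<bar>W x\<bar> * e" .
      qed (use that in auto)
      finally show ?thesis by (simp add: mult_ac)
    qed
    ultimately show ?thesis by (rule has_integral_le)
  qed
  have "integral {0..a} (\<lambda>x. x * (W x)\<^sup>2) \<le> 0"
  proof (rule field_le_epsilon)
    fix d :: real assume "0 < d"
    \<comment> \<open>\<open>C + 1\<close> instead of \<open>C\<close> avoids a division by zero.\<close>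
    have "d / (C + 1) * C \<le> d"
      using C \<open>0 < d\<close> by (simp add: field_simps)
    with small[of "d / (C + 1)"] C \<open>0 < d\<close>
    show "integral {0..a} (\<lambda>x. x * (W x)\<^sup>2) \<le> 0 + d" by auto
  qed
  moreover have "0 \<le> integral {0..a} (\<lambda>x. x * (W x)\<^sup>2)"
    by (intro integral_nonneg intg) auto
  ultimately have "((\<lambda>x. x * (W x)\<^sup>2) has_integral 0) (cbox 0 a)"
    using integrable_integral[OF intg(1)] by auto
  then have "x * (W x)\<^sup>2 = 0"
    by (rule has_integral_0_cbox_imp_0[rotated 2])
       (use \<open>0 < a\<close> x in \<open>auto intro!: continuous_intros cont\<close>)
  then show ?thesis using x by simp
qed

text \<open>
  The function \<open>h\<close> may be unbounded near the ends and need not be absolutely integrable. Its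
  primitive \<open>W\<close> is continuous on \<open>[0,a]\<close>; the moment \<open>k = 0\<close> gives \<open>W a = 0\<close>, so the boundary
  terms vanish when \<open>x^(2k+2) h\<close> is integrated by parts, and the higher moments of \<open>h\<close> turn into odd
  moments of \<open>W\<close>.
\<close>

lemma zero_if_even_moments_zero:
  fixes h :: "real \<Rightarrow> real"
  assumes cont: "continuous_on {0<..<a} h"
    and mom: "\<And>k. ((\<lambda>x. x ^ (2 * k) * h x) has_integral 0) {0<..<a}"
    and x: "x \<in> {0<..<a}"
  shows "h x = 0"
proof -
  have "0 < a" using x by auto
  have h0: "(h has_integral 0) {0..a}"
    using mom[of 0] by (simp add: has_integral_Icc_iff_Ioo)
  define W where "W = (\<lambda>x. integral {0..x} h)"
  have contW: "continuous_on {0..a} W"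
    unfolding W_def using h0 by (intro indefinite_integral_continuous_1) auto
  have W0: "W 0 = 0" and Wa: "W a = 0" using h0 by (auto simp: W_def)
  have W': "(W has_real_derivative h y) (at y)" if y: "y \<in> {0<..<a}" for y
  proof -
    have "isCont h y" using cont y by (simp add: continuous_on_eq_continuous_at)
    then have "(W has_vector_derivative h y) (at y within {0..a})"
      unfolding W_def using h0 y
      by (intro integral_has_vector_derivative_continuous_at[where S = "{}" and a = 0 and b = a, simplified])
         (auto intro: continuous_at_imp_continuous_at_within)
    then have "(W has_vector_derivative h y) (at y)"
      using y by (simp add: at_within_Icc_at)
    then show ?thesis by (simp add: has_real_derivative_iff_has_vector_derivative)
  qed
  have "((\<lambda>x. x ^ (2 * k + 1) * W x) has_integral 0) {0..a}" for k
  proof -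
    define n where "n = 2 * k + 1"
    have lim: "((\<lambda>x. x ^ Suc n * W x) \<longlongrightarrow> 0) (at_right 0)" "((\<lambda>x. x ^ Suc n * W x) \<longlongrightarrow> 0) (at_left a)"
    proof -
      have "continuous_on {0..a} (\<lambda>x. x ^ Suc n * W x)"
        by (intro continuous_intros contW)
      from continuous_on_Icc_at_rightD[OF this \<open>0 < a\<close>] continuous_on_Icc_at_leftD[OF this \<open>0 < a\<close>]
      show "((\<lambda>x. x ^ Suc n * W x) \<longlongrightarrow> 0) (at_right 0)" "((\<lambda>x. x ^ Suc n * W x) \<longlongrightarrow> 0) (at_left a)"
        by (simp_all add: W0 Wa)
    qed
    have "((\<lambda>x. x ^ Suc n * h x + real (Suc n) * (x ^ n * W x)) has_integral 0 - 0) {0<..<a}"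
    proof (rule has_integral_derivative_open[OF \<open>0 < a\<close> _ lim])
      fix y assume "y \<in> {0<..<a}"
      from DERIV_mult[OF DERIV_pow[of "Suc n"] W'[OF this]]
      show "((\<lambda>x. x ^ Suc n * W x) has_real_derivative
          y ^ Suc n * h y + real (Suc n) * (y ^ n * W y)) (at y)"
        by (rule DERIV_cong) simp
    qed
    from has_integral_diff[OF this mom[of "Suc k"]]
    have "((\<lambda>x. real (Suc n) * (x ^ n * W x)) has_integral 0) {0<..<a}"
      by (simp add: n_def)
    from has_integral_mult_right[OF this, of "1 / real (Suc n)"]
    show ?thesis by (simp add: n_def has_integral_Icc_iff_Ioo)
  qed
  then have zero: "W y = 0" if "y \<in> {0<..<a}" for y
    using zero_if_odd_moments_zero[OF \<open>0 < a\<close> contW, of y] that by auto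
  have "((\<lambda>y. 0) has_real_derivative h x) (at x)"
    by (rule has_field_derivative_transform_within_open[OF W'[OF x], of "{0<..<a}"])
       (use x zero in auto)
  then show ?thesis using DERIV_unique[OF _ DERIV_const] by metis
qed

section \<open>Lagrange's identity and the boundary terms\<close>

text \<open>
  The bilinear concomitant of \<open>y\<close> with the multiplier \<open>x^n\<close>: if \<open>p\<close>, \<open>q\<close>, \<open>r\<close> are the
  coefficients of \<open>y'''\<close>, \<open>y''\<close>, \<open>y'\<close> in the equation, integration by parts of \<open>x^n L y\<close> leaves
  the boundary term
  \<open>p x^n y'' + (q x^n - (p x^n)') y' + (r x^n - (q x^n)' + (p x^n)'') y\<close>.
  This is \<open>x^(n-1)\<close> times the expression below, grouped into the products whose limits at \<open>0\<close> are
  prescribed. Splitting off \<open>x^(n-1)\<close>, an even power for odd \<open>n\<close>, leaves an expression that still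
  tends to \<open>0\<close> at both ends. The arguments \<open>y\<close>, \<open>y1\<close>, \<open>y2\<close> stand for the values of \<open>y\<close> and its
  first two derivatives at \<open>x\<close>.
\<close>

definition concomitant :: "real \<Rightarrow> real \<Rightarrow> real \<Rightarrow> real \<Rightarrow> real \<Rightarrow> real" where
  "concomitant n x y y1 y2 =
     (27 * x ^ 2 - 256) * (x ^ 3 * y2)
   + (27 * (2 - n) * x ^ 2 + 256 * (n - 1)) * (x ^ 2 * y1)
   + ((27 * (n + 3) * (n - 2) + 177) * x ^ 2 - 256 * (n + 1) * (n - 1) - 192) * (x * y)"

text \<open>
  The part of the derivative without \<open>L f\<close> is \<open>- f L\<^sup>* x^n\<close> for \<open>n = 2k+1\<close>. The coefficient of
  \<open>f x^(n+1)\<close> is the cubic \<open>(3n+5) (3n+3) (3n+1)\<close>, that of \<open>f x^(n-1)\<close> is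
  \<open>- 64 n (2n-1) (2n+1)\<close>; in terms of \<open>k\<close> these are, up to sign, \<open>8\<close> times
  the two factors in the recurrence.
\<close>

lemma lagrange_identity:
  fixes f f1 f2 :: "real \<Rightarrow> real"
  assumes "(f has_real_derivative f1 x) (at x)" "(f1 has_real_derivative f2 x) (at x)"
    "(f2 has_real_derivative y3) (at x)"
  shows "((\<lambda>x. x ^ (2 * k) * concomitant (2 * real k + 1) x (f x) (f1 x) (f2 x)) has_real_derivative
     x ^ (2 * k) * (x * ((27 * x ^ 4 - 256 * x ^ 2) * y3 + (162 * x ^ 3 - 768 * x) * f2 x
       + (177 * x ^ 2 - 192) * f1 x + 15 * x * f x))
     + (8 * ((3 * real k + 4) * (3 * real k + 3) * (3 * real k + 2)) * (f x * x ^ (2 * Suc k))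
        - 8 * (4 * (4 * real k + 3) * (4 * real k + 2) * (4 * real k + 1)) * (f x * x ^ (2 * k)))) (at x)"
proof -
  have X: "((\<lambda>x::real. x * x ^ (2 * k)) has_real_derivative (2 * real k + 1) * x ^ (2 * k)) (at x)"
    using DERIV_pow[of "2 * k + 1" x UNIV] by (simp add: algebra_simps)
  define n where "n = 2 * real k + 1"
  define p q r where "p = (\<lambda>x::real. 27 * x ^ 4 - 256 * x ^ 2)"
    and "q = (\<lambda>x::real. 27 * (2 - n) * x ^ 3 + 256 * (n - 1) * x)"
    and "r = (\<lambda>x::real. (27 * (n + 3) * (n - 2) + 177) * x ^ 2 - 256 * (n + 1) * (n - 1) - 192)"
  have eq: "(\<lambda>x. x ^ (2 * k) * concomitant (2 * real k + 1) x (f x) (f1 x) (f2 x))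
     = (\<lambda>x. (x * x ^ (2 * k)) * (p x * f2 x + q x * f1 x + r x * f x))"
    unfolding concomitant_def n_def[symmetric] p_def q_def r_def
    by (rule ext) (simp add: algebra_simps power2_eq_square power3_eq_cube power4_eq_xxxx)
  have d: "(p has_real_derivative 108 * x ^ 3 - 512 * x) (at x)"
    "(q has_real_derivative 81 * (2 - n) * x ^ 2 + 256 * (n - 1)) (at x)"
    "(r has_real_derivative 2 * (27 * (n + 3) * (n - 2) + 177) * x) (at x)"
    unfolding p_def q_def r_def by (auto intro!: derivative_eq_intros)
  have "((\<lambda>x. (x * x ^ (2 * k)) * (p x * f2 x + q x * f1 x + r x * f x)) has_real_derivative
      ((2 * real k + 1) * x ^ (2 * k)) * (p x * f2 x + q x * f1 x + r x * f x)
    + (((108 * x ^ 3 - 512 * x) * f2 x + y3 * p x)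
       + ((81 * (2 - n) * x ^ 2 + 256 * (n - 1)) * f1 x + f2 x * q x)
       + (2 * (27 * (n + 3) * (n - 2) + 177) * x * f x + f1 x * r x)) * (x * x ^ (2 * k))) (at x)"
    by (intro DERIV_mult DERIV_add X d assms)
  then show ?thesis
    unfolding eq
  proof (rule DERIV_cong, goal_cases)
    case 1
    define Z K where "Z = x ^ (2 * k)" and "K = real k"
    have Suc_k: "x ^ (2 * Suc k) = x * x * Z" by (simp add: Z_def)
    show ?case
      unfolding p_def q_def r_def n_def Suc_k Z_def[symmetric] K_def[symmetric]
      by (simp add: algebra_simps power2_eq_square power3_eq_cube power4_eq_xxxx)
  qed
qed

lemma concomitant_tendsto_0_at_0:
  assumes "((\<lambda>x. x * f x) \<longlongrightarrow> 0) (at_right 0)"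
    and "((\<lambda>x. x ^ 2 * f1 x) \<longlongrightarrow> 0) (at_right 0)"
    and "((\<lambda>x. x ^ 3 * f2 x) \<longlongrightarrow> 0) (at_right 0)"
  shows "((\<lambda>x. concomitant n x (f x) (f1 x) (f2 x)) \<longlongrightarrow> 0) (at_right 0)"
  unfolding concomitant_def
  by (rule tendsto_eq_intros assms refl)+ simp

text \<open>
  The leading coefficient \<open>27 x\<^sup>2 - 256\<close> vanishes at \<open>a\<close>, so the \<open>y''\<close> term contains \<open>(x - a) y''\<close>.
  Completing it to \<open>2 (x - a) y'' + y'\<close> changes the coefficient of \<open>y'\<close> into one that also vanishes
  at \<open>a\<close>, and the limit of \<open>(x - a) y'\<close> takes care of that term.
\<close>

lemma concomitant_tendsto_0_at_a:
  fixes a n :: real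
  assumes a: "27 * a\<^sup>2 = 256"
    and f: "(f \<longlongrightarrow> 0) (at_left a)"
    and f1: "((\<lambda>x. (x - a) * f1 x) \<longlongrightarrow> 0) (at_left a)"
    and f2: "((\<lambda>x. 2 * (x - a) * f2 x + f1 x) \<longlongrightarrow> 0) (at_left a)"
  shows "((\<lambda>x. concomitant n x (f x) (f1 x) (f2 x)) \<longlongrightarrow> 0) (at_left a)"
proof -
  have eq: "concomitant n x y y1 y2 =
      27 / 2 * x ^ 3 * (x + a) * (2 * (x - a) * y2 + y1)
    + 27 * x ^ 2 * ((3 / 2 - n) * x - (n - 1) * a) * ((x - a) * y1)
    + ((27 * (n + 3) * (n - 2) + 177) * x ^ 2 - 256 * (n + 1) * (n - 1) - 192) * x * y"
    for x y y1 y2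
    unfolding concomitant_def a[symmetric]
    by (simp add: field_simps power2_eq_square power3_eq_cube)
  show ?thesis
    unfolding eq
    by (rule tendsto_eq_intros f f1 f2 refl)+ simp
qed

section \<open>The differential equation\<close>

theorem theorem6p2:
  fixes a :: real and f :: "real \<Rightarrow> real"
  assumes a: "a = 16 / (3 * sqrt 3)"
    and moments: "\<And>k::nat. ((\<lambda>x. f x * x ^ (2 * k)) has_integral D_num 3 k) {0<..<a}"
    and C3: "times_continuously_differentiable_on 3 f {0<..<a}"
    and lim_f_a: "(f \<longlongrightarrow> 0) (at_left a)"
    and lim_f1_a: "((\<lambda>x. (x - a) * deriv f x) \<longlongrightarrow> 0) (at_left a)"
    and lim_f2_a: "((\<lambda>x. 2 * (x - a) * (deriv ^^ 2) f x + deriv f x) \<longlongrightarrow> 0) (at_left a)"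
    and lim_f_0: "((\<lambda>x. x * f x) \<longlongrightarrow> 0) (at_right 0)"
    and lim_f1_0: "((\<lambda>x. x ^ 2 * deriv f x) \<longlongrightarrow> 0) (at_right 0)"
    and lim_f2_0: "((\<lambda>x. x ^ 3 * (deriv ^^ 2) f x) \<longlongrightarrow> 0) (at_right 0)"
  shows "\<forall>x\<in>{0<..<a}.
      (27 * x ^ 4 - 256 * x ^ 2) * (deriv ^^ 3) f x
    + (162 * x ^ 3 - 768 * x) * (deriv ^^ 2) f x
    + (177 * x ^ 2 - 192) * deriv f x
    + 15 * x * f x = 0"
proof -
  have "0 < a" by (simp add: a)
  have a2: "27 * a\<^sup>2 = 256" by (simp add: a power_divide power_mult_distrib)
  have D: "((deriv ^^ j) f has_real_derivative (deriv ^^ Suc j) f x) (at x)"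
    if "j < 3" "x \<in> {0<..<a}" for j x
    using C3 that unfolding times_continuously_differentiable_on_def
    by (auto simp: real_differentiable_def DERIV_imp_deriv dest!: spec[of _ j] bspec[of _ _ x])
  have D0: "(f has_real_derivative deriv f x) (at x)"
    and D1: "(deriv f has_real_derivative (deriv ^^ 2) f x) (at x)"
    and D2: "((deriv ^^ 2) f has_real_derivative (deriv ^^ 3) f x) (at x)"
    if "x \<in> {0<..<a}" for x
    using D[of 0 x] D[of 1 x] D[of 2 x] that by (simp_all add: numeral_eq_Suc)
  define g where "g = (\<lambda>x. (27 * x ^ 4 - 256 * x ^ 2) * (deriv ^^ 3) f x
    + (162 * x ^ 3 - 768 * x) * (deriv ^^ 2) f x
    + (177 * x ^ 2 - 192) * deriv f x
    + 15 * x * f x)"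
  have "continuous_on {0<..<a} ((deriv ^^ 3) f)"
    using C3 by (simp add: times_continuously_differentiable_on_def)
  moreover have "continuous_on {0<..<a} ((deriv ^^ 2) f)" "continuous_on {0<..<a} (deriv f)"
    "continuous_on {0<..<a} f"
    by (intro continuous_at_imp_continuous_on ballI, erule DERIV_isCont[OF D2] DERIV_isCont[OF D1]
        DERIV_isCont[OF D0])+
  ultimately have cont: "continuous_on {0<..<a} (\<lambda>x. x * g x)"
    unfolding g_def by (intro continuous_intros)
  have mom: "((\<lambda>x. x ^ (2 * k) * (x * g x)) has_integral 0) {0<..<a}" for k
  proof -
    define B where "B = (\<lambda>x. x ^ (2 * k) * concomitant (2 * real k + 1) x (f x) (deriv f x) ((deriv ^^ 2) f x))"
    define A C where "A = (3 * real k + 4) * (3 * real k + 3) * (3 * real k + 2)"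
      and "C = 4 * (4 * real k + 3) * (4 * real k + 2) * (4 * real k + 1)"
    have B0: "(B \<longlongrightarrow> 0) (at_right 0)"
      unfolding B_def
      by (rule tendsto_mult_right_zero concomitant_tendsto_0_at_0 lim_f_0 lim_f1_0 lim_f2_0
          tendsto_eq_intros refl)+ simp
    have Ba: "(B \<longlongrightarrow> 0) (at_left a)"
      unfolding B_def
      by (rule concomitant_tendsto_0_at_a[OF a2 lim_f_a lim_f1_a lim_f2_a] tendsto_eq_intros refl)+ simp
    have total: "((\<lambda>x. x ^ (2 * k) * (x * g x)
        + (8 * A * (f x * x ^ (2 * Suc k)) - 8 * C * (f x * x ^ (2 * k)))) has_integral 0 - 0) {0<..<a}"
      by (rule has_integral_derivative_open[OF \<open>0 < a\<close> _ B0 Ba])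
         (use lagrange_identity[OF D0 D1 D2] in \<open>simp add: B_def g_def A_def C_def\<close>)
    have "((\<lambda>x. 8 * A * (f x * x ^ (2 * Suc k)) - 8 * C * (f x * x ^ (2 * k)))
        has_integral 8 * A * D_num 3 (Suc k) - 8 * C * D_num 3 k) {0<..<a}"
      by (intro has_integral_diff has_integral_mult_right moments)
    moreover have "8 * A * D_num 3 (Suc k) - 8 * C * D_num 3 k = 0"
      using D_num_3_Suc[of k] by (simp add: A_def C_def)
    ultimately have "((\<lambda>x. 8 * A * (f x * x ^ (2 * Suc k)) - 8 * C * (f x * x ^ (2 * k)))
        has_integral 0) {0<..<a}"
      by (simp only:)
    from has_integral_diff[OF total this] show ?thesis
      by (simp only: add_diff_cancel_right' diff_0_right)
  qed
  have "g x = 0" if "x \<in> {0<..<a}" for x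
    using zero_if_even_moments_zero[OF cont mom that] that by simp
  then show ?thesis unfolding g_def by blast
qed

end
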